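(* Suppose that the following two conditions hold. $(gL_0)$: $\lim_{\lambda\to\infty}\sup_{y\in\mathbb R}\big\|\frac{\delta_t(\lambda(0,y))}{\lambda}\big\|_\infty=0$ for $t=0,\dots,T$. $(L_1)$: for each $t\in\{0,1,\dots,T\}$ and $y\in\mathbb R$ there is an $\mathcal F_t$-measurable positive random variable $c_t(y)$ such that $L_t(0,y)\le\bar L_t(0,y)-c_t(y)$ for $y\neq0$. Then the conditions $(A)$, $(SA)$ and $(\overline{SA})$ are equivalent.
   Context: Market with concave transaction costs. Let $(\Omega,\mathcal F,(\mathcal F_t)_{t=0,\dots,T},\mathbb P)$ be a filtered probability space in discrete time; all relations between random variables hold $\mathbb P$-a.e. There are fixed-cost constants $b_0\le 0\le a_0$. For each $t$ there are $\mathcal F_t$-measurable random price curves, a bid curve $m\mapsto\underline S_t(m)$, $m\ge0$, and an ask curve $l\mapsto\overline S_t(l)$, $l\ge0$. Selling $m$ assets yields $b_t(m)=b_0+m\underline S_t(m)$; buying $l$ assets costs $a_t(l)=a_0+l\overline S_t(l)$. Standing assumptions: (a1) $m\mapsto\underline S_t(m)$ is increasing and continuous with limit $\underline S_t(\infty)$ at $\infty$, differentiable for large $m$, and $\lim_{m\to\infty}m\underline S_t'(m)=0$; (a2) $m\mapsto b_t(m)$ is increasing and convex; (a3) $l\mapsto\overline S_t(l)$ is decreasing and continuous with limit $\overline S_t(\infty)$ at $\infty$, differentiable for large $l$, and $\lim_{l\to\infty}l\overline S_t'(l)=0$; (a4) $l\mapsto a_t(l)$ is increasing and concave; (a5) $\underline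 S_t(\infty)<\overline S_t(\infty)$. (Price curves constant in the volume are admitted.) $L_t(x,y)=x+(b_t(y))^+$ if $y\ge0$, $L_t(x,y)=x-a_t(-y)$ if $y<0$; $G_t=\{(x,y)\in\mathbb R^2: L_t(x,y)\ge0\}$. $\bar L_t(x,y)=x+y\,\underline S_t(\infty)$ if $y\ge0$, $\bar L_t(x,y)=x+y\,\overline S_t(\infty)$ if $y<0$; $\bar K_t=\{\bar L_t\ge0\}$ (the closure of the convex hull of $G_t$). $\delta_t(x,y)=\bar L_t(x,y)-L_t(x,y)$. $L^0(A_t,\mathcal F_t)$ is the set of $\mathcal F_t$-measurable random variables with values in $A_t$. $\|\cdot\|_\infty$ is the $L^\infty(\mathbb P)$ norm. Arbitrage $(A)$: there is $V_T=\sum_{t=0}^T\xi_t$ with $\xi_t\in L^0(-G_t,\mathcal F_t)$ such that $L_T(V_T)\ge0$ a.e. and $\mathbb P\{L_T(V_T)>0\}>0$. Strong arbitrage $(SA)$: there are $t\in\{0,\dots,T\}$, $B_t\in\mathcal F_t$ with $\mathbb P(B_t)>0$, $\xi_i\in L^0(-G_i,\mathcal F_i)$ ($i=0,\dots,T$) and an $\mathcal F_t$-measurable $m_t\geq 0$ such that $\xi_i=0$ for $i\le t-1$, $\xi_i=0$ on $B_t^c$ for $i\ge t$, and $V_T=\sum_{i=0}^T\xi_i$ satisfies $L_T(V_T)\ge m_t>0$ on $B_t$. $(\overline{SA})$ is the same notion with $G_i$ replaced by $\bar K_i$ (and $L_T$ by $\bar L_T$). *)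

theory Defs
  imports "HOL-Probability.Probability"
begin

definition liquidation_value ::
    "real \<Rightarrow> real \<Rightarrow> (real \<Rightarrow> real) \<Rightarrow> (real \<Rightarrow> real) \<Rightarrow> real \<times> real \<Rightarrow> real" where
  "liquidation_value b0 a0 bid ask z =
     (if snd z \<ge> 0 then fst z + max 0 (b0 + snd z * bid (snd z))
      else fst z - (a0 + (- snd z) * ask (- snd z)))"

definition limit_liquidation_value :: "real \<Rightarrow> real \<Rightarrow> real \<times> real \<Rightarrow> real" where
  "limit_liquidation_value bid_inf ask_inf z =
     (if snd z \<ge> 0 then fst z + snd z * bid_inf else fst z + snd z * ask_inf)"

text \<open>
  \<open>Sb t \<omega>\<close> and \<open>Sa t \<omega>\<close> are the bid and the ask curve at time \<open>t\<close>; only their values on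
  \<open>{0..}\<close> matter. \<open>sb t\<close> and \<open>sa t\<close> are versions of their limits at infinity. The path
  properties are required for almost every \<open>\<omega>\<close>, and the \<open>\<sigma>\<close>-algebras need not be complete.
  Monotonicity is not strict, so price curves that are constant in the volume are admitted.
\<close>

locale concave_cost_market = prob_space M
  for M :: "'a measure" +
  fixes F :: "nat \<Rightarrow> 'a measure" and T :: nat
    and b0 a0 :: real
    and Sb Sa :: "nat \<Rightarrow> 'a \<Rightarrow> real \<Rightarrow> real"
    and sb sa :: "nat \<Rightarrow> 'a \<Rightarrow> real"
  assumes subalgebra_F: "\<And>t. t \<le> T \<Longrightarrow> subalgebra M (F t)"
    and F_mono: "\<And>s t. s \<le> t \<Longrightarrow> t \<le> T \<Longrightarrow> subalgebra (F t) (F s)"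
    and fixed_costs: "b0 \<le> 0" "0 \<le> a0"
    and bid_measurable: "\<And>t m. t \<le> T \<Longrightarrow> 0 \<le> m \<Longrightarrow> (\<lambda>\<omega>. Sb t \<omega> m) \<in> borel_measurable (F t)"
    and ask_measurable: "\<And>t l. t \<le> T \<Longrightarrow> 0 \<le> l \<Longrightarrow> (\<lambda>\<omega>. Sa t \<omega> l) \<in> borel_measurable (F t)"
    and bid_limit_measurable: "\<And>t. t \<le> T \<Longrightarrow> sb t \<in> borel_measurable (F t)"
    and ask_limit_measurable: "\<And>t. t \<le> T \<Longrightarrow> sa t \<in> borel_measurable (F t)"
    and bid_curve: "\<And>t. t \<le> T \<Longrightarrow> AE \<omega> in M.
          mono_on {0..} (Sb t \<omega>) \<and> continuous_on {0..} (Sb t \<omega>) \<and>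
          (Sb t \<omega> \<longlongrightarrow> sb t \<omega>) at_top \<and>
          (\<forall>\<^sub>F m in at_top. Sb t \<omega> differentiable (at m)) \<and>
          ((\<lambda>m. m * deriv (Sb t \<omega>) m) \<longlongrightarrow> 0) at_top"
    and sell_value: "\<And>t. t \<le> T \<Longrightarrow> AE \<omega> in M.
          mono_on {0..} (\<lambda>m. b0 + m * Sb t \<omega> m) \<and> convex_on {0..} (\<lambda>m. b0 + m * Sb t \<omega> m)"
    and ask_curve: "\<And>t. t \<le> T \<Longrightarrow> AE \<omega> in M.
          antimono_on {0..} (Sa t \<omega>) \<and> continuous_on {0..} (Sa t \<omega>) \<and>
          (Sa t \<omega> \<longlongrightarrow> sa t \<omega>) at_top \<and>
          (\<forall>\<^sub>F l in at_top. Sa t \<omega> differentiable (at l)) \<and>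
          ((\<lambda>l. l * deriv (Sa t \<omega>) l) \<longlongrightarrow> 0) at_top"
    and buy_cost: "\<And>t. t \<le> T \<Longrightarrow> AE \<omega> in M.
          mono_on {0..} (\<lambda>l. a0 + l * Sa t \<omega> l) \<and> concave_on {0..} (\<lambda>l. a0 + l * Sa t \<omega> l)"
    and bid_less_ask: "\<And>t. t \<le> T \<Longrightarrow> AE \<omega> in M. sb t \<omega> < sa t \<omega>"

definition market_L :: "real \<Rightarrow> real \<Rightarrow> (nat \<Rightarrow> 'a \<Rightarrow> real \<Rightarrow> real) \<Rightarrow> (nat \<Rightarrow> 'a \<Rightarrow> real \<Rightarrow> real)
    \<Rightarrow> nat \<Rightarrow> 'a \<Rightarrow> real \<times> real \<Rightarrow> real" where
  "market_L b0 a0 Sb Sa t \<omega> = liquidation_value b0 a0 (Sb t \<omega>) (Sa t \<omega>)"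

definition market_Lbar :: "(nat \<Rightarrow> 'a \<Rightarrow> real) \<Rightarrow> (nat \<Rightarrow> 'a \<Rightarrow> real)
    \<Rightarrow> nat \<Rightarrow> 'a \<Rightarrow> real \<times> real \<Rightarrow> real" where
  "market_Lbar sb sa t \<omega> = limit_liquidation_value (sb t \<omega>) (sa t \<omega>)"

definition solvency_set ::
    "(nat \<Rightarrow> 'a \<Rightarrow> real \<times> real \<Rightarrow> real) \<Rightarrow> nat \<Rightarrow> 'a \<Rightarrow> (real \<times> real) set" where
  "solvency_set L t \<omega> = {z. L t \<omega> z \<ge> 0}"

definition L0 :: "'a measure \<Rightarrow> 'a measure \<Rightarrow> ('a \<Rightarrow> (real \<times> real) set) \<Rightarrow> ('a \<Rightarrow> real \<times> real) set" where
  "L0 M N A = {\<xi> \<in> borel_measurable N. AE \<omega> in M. \<xi> \<omega> \<in> A \<omega>}"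

text \<open>
  In \<open>arbitrage\<close> the probability is taken in the completion of \<open>M\<close>: since the price
  curves are continuous only almost surely, \<open>L T \<omega> (V \<omega>)\<close> is in general only equal almost
  everywhere to a measurable function of \<open>\<omega>\<close>.
\<close>

definition arbitrage :: "'a measure \<Rightarrow> (nat \<Rightarrow> 'a measure) \<Rightarrow> nat
    \<Rightarrow> (nat \<Rightarrow> 'a \<Rightarrow> real \<times> real \<Rightarrow> real) \<Rightarrow> bool" where
  "arbitrage M F T L \<longleftrightarrow>
     (\<exists>\<xi> V. (\<forall>t\<le>T. \<xi> t \<in> L0 M (F t) (\<lambda>\<omega>. uminus ` solvency_set L t \<omega>)) \<and>
        V = (\<lambda>\<omega>. \<Sum>t\<le>T. \<xi> t \<omega>) \<and>
        (AE \<omega> in M. L T \<omega> (V \<omega>) \<ge> 0) \<and>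
        measure (completion M) {\<omega> \<in> space M. L T \<omega> (V \<omega>) > 0} > 0)"

definition strong_arbitrage :: "'a measure \<Rightarrow> (nat \<Rightarrow> 'a measure) \<Rightarrow> nat
    \<Rightarrow> (nat \<Rightarrow> 'a \<Rightarrow> real \<times> real \<Rightarrow> real) \<Rightarrow> bool" where
  "strong_arbitrage M F T L \<longleftrightarrow>
     (\<exists>t\<le>T. \<exists>B \<in> sets (F t). measure M B > 0 \<and>
       (\<exists>\<xi> m V. (\<forall>i\<le>T. \<xi> i \<in> L0 M (F i) (\<lambda>\<omega>. uminus ` solvency_set L i \<omega>)) \<and>
          m \<in> borel_measurable (F t) \<and> (AE \<omega> in M. m \<omega> \<ge> 0) \<and>
          (\<forall>i<t. AE \<omega> in M. \<xi> i \<omega> = 0) \<and>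
          (\<forall>i\<in>{t..T}. AE \<omega> in M. \<omega> \<notin> B \<longrightarrow> \<xi> i \<omega> = 0) \<and>
          V = (\<lambda>\<omega>. \<Sum>i\<le>T. \<xi> i \<omega>) \<and>
          (AE \<omega> in M. \<omega> \<in> B \<longrightarrow> L T \<omega> (V \<omega>) \<ge> m \<omega> \<and> m \<omega> > 0)))"

definition Linf_norm :: "'a measure \<Rightarrow> ('a \<Rightarrow> real) \<Rightarrow> ereal" where
  "Linf_norm M f = esssup M (\<lambda>\<omega>. ereal \<bar>f \<omega>\<bar>)"

definition cond_gL0 :: "'a measure \<Rightarrow> nat \<Rightarrow> (nat \<Rightarrow> 'a \<Rightarrow> real \<times> real \<Rightarrow> real)
    \<Rightarrow> (nat \<Rightarrow> 'a \<Rightarrow> real \<times> real \<Rightarrow> real) \<Rightarrow> bool" where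
  "cond_gL0 M T L Lbar \<longleftrightarrow>
     (\<forall>t\<le>T. ((\<lambda>r::real. SUP y::real.
          Linf_norm M (\<lambda>\<omega>. (Lbar t \<omega> (r *\<^sub>R (0, y)) - L t \<omega> (r *\<^sub>R (0, y))) / r))
        \<longlongrightarrow> 0) at_top)"

definition cond_L1 :: "'a measure \<Rightarrow> (nat \<Rightarrow> 'a measure) \<Rightarrow> nat
    \<Rightarrow> (nat \<Rightarrow> 'a \<Rightarrow> real \<times> real \<Rightarrow> real) \<Rightarrow> (nat \<Rightarrow> 'a \<Rightarrow> real \<times> real \<Rightarrow> real) \<Rightarrow> bool" where
  "cond_L1 M F T L Lbar \<longleftrightarrow>
     (\<forall>t\<le>T. \<forall>y::real. \<exists>c \<in> borel_measurable (F t).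
        (AE \<omega> in M. c \<omega> > 0) \<and>
        (y \<noteq> 0 \<longrightarrow> (AE \<omega> in M. L t \<omega> (0, y) \<le> Lbar t \<omega> (0, y) - c \<omega>)))"

end

theory Submission
  imports Defs
begin

text \<open>
  The argument compares the transaction-cost market with its large-volume limit, the market with
  proportional costs whose liquidation value is \<open>Lbar\<close>. Everything rests on the gap \<open>Lbar - L\<close>
  between the two values. On each of the two half-lines of volumes (selling, buying) this gap is
  a nonnegative concave function of the volume. Concavity makes knowledge at integer volumes
  sufficient, so the two hypotheses, each of which holds outside a null set that depends on
  the volume, become statements about all volumes at once outside a single null set: by
  \<open>(L\<^sub>1)\<close> the gap is strictly positive whenever an asset is actually traded
  (\<open>limit_value_strictly_better\<close>), and by \<open>(gL\<^sub>0)\<close> it is bounded by one constant \<open>C\<close>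
  (\<open>limit_value_gap_bounded\<close>).

  Given these two facts the equivalence is a cycle.
  A strong arbitrage is an arbitrage, since outside the event \<open>B\<close> nothing is ever
  traded and the terminal value is \<open>0\<close>.
  Given an arbitrage, consider the first date \<open>t\<close> at which something is traded.
  On the event \<open>B\<close> that the trade \<open>\<xi>\<close> at \<open>t\<close> does not vanish, its value \<open>Lbar (- \<xi>)\<close> in
  the limit market is strictly positive, either because the gap is or because cash
  is thrown away. This amount is known at time \<open>t\<close>; collecting it at once and then
  following the arbitrage on \<open>B\<close> is a strong arbitrage of the limit market.
  Finally, the limit market is a cone, so a strong arbitrage in it can be multiplied by an
  arbitrarily large factor known at time \<open>t\<close>; the gain then outweighs the bounded cost \<open>C\<close>
  per date of carrying out the same trades in the market with transaction costs.
\<close>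

section \<open>Nonnegative concave functions on the half-line\<close>

text \<open>A positive \<open>y\<close> lies strictly between \<open>0\<close> and some integer, and on that open interval the
  chord, which \<open>f\<close> dominates, is positive.\<close>

lemma concave_on_pos_from_integers:
  fixes f :: "real \<Rightarrow> real"
  assumes conc: "concave_on {0..} f" and nonneg: "\<And>y. 0 \<le> y \<Longrightarrow> 0 \<le> f y"
    and pos: "\<And>n. 0 < f (real (Suc n))" and y: "0 < y"
  shows "0 < f y"
proof -
  obtain n where n: "y < real n" using reals_Archimedean2 by blast
  define N where "N = real (Suc n)"
  have N: "y < N" "0 < N" "0 < f N" using n pos[of n] y by (auto simp: N_def)
  have "(1 - y / N) * f 0 + (y / N) * f N \<le> f ((1 - y / N) *\<^sub>R 0 + (y / N) *\<^sub>R N)"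
    using N y by (intro concave_onD[OF conc]) auto
  also have "\<dots> = f y" using N by simp
  finally have "(1 - y / N) * f 0 + (y / N) * f N \<le> f y" .
  moreover have "0 \<le> (1 - y / N) * f 0" using nonneg[of 0] N y by (intro mult_nonneg_nonneg) auto
  moreover have "0 < (y / N) * f N" using N y by simp
  ultimately show ?thesis by linarith
qed

text \<open>A nonnegative concave function is nondecreasing, so that it would be bounded by \<open>C\<close> itself;
  the factor \<open>2\<close> comes from using one chord, from \<open>y\<close> through a larger integer \<open>N\<close> to
  \<open>2 N\<close>, whose left end has weight at least one half.\<close>

lemma concave_on_bounded_from_integers:
  fixes f :: "real \<Rightarrow> real"
  assumes conc: "concave_on {0..} f" and nonneg: "\<And>y. 0 \<le> y \<Longrightarrow> 0 \<le> f y"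
    and bound: "\<And>n. f (real (Suc n)) \<le> C" and y: "0 \<le> y"
  shows "f y \<le> 2 * C"
proof -
  obtain n where n: "y < real n" using reals_Archimedean2 by blast
  define N where "N = real (Suc n)"
  have N: "y < N" "0 < N" "f N \<le> C" using n y bound[of n] by (auto simp: N_def)
  define s where "s = (N - y) / (2 * N - y)"
  have s: "0 \<le> s" "s \<le> 1 / 2" using N y by (auto simp: s_def field_simps)
  have s_eq: "s * (2 * N - y) = N - y" using N by (simp add: s_def)
  have "(1 - s) * f y + s * f (2 * N) \<le> f ((1 - s) *\<^sub>R y + s *\<^sub>R (2 * N))"
    using N y s by (intro concave_onD[OF conc]) auto
  also have "(1 - s) *\<^sub>R y + s *\<^sub>R (2 * N) = N"
    using s_eq by (simp add: algebra_simps)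
  finally have "(1 - s) * f y + s * f (2 * N) \<le> C" using N by simp
  moreover have "0 \<le> s * f (2 * N)" using nonneg[of "2 * N"] N s by simp
  moreover have "(1 / 2) * f y \<le> (1 - s) * f y"
    using s nonneg[OF y] by (intro mult_right_mono) auto
  ultimately show ?thesis by linarith
qed

lemma concave_on_linear_minus_pos_part:
  fixes b :: "real \<Rightarrow> real"
  assumes "convex_on {0..} b"
  shows "concave_on {0..} (\<lambda>y. y * s - max 0 (b y))"
  unfolding concave_on_iff
proof (intro conjI ballI allI impI)
  fix x y u v :: real
  assume h: "x \<in> {0..}" "y \<in> {0..}" "0 \<le> u" "0 \<le> v" "u + v = 1"
  have "b (u *\<^sub>R x + v *\<^sub>R y) \<le> u * b x + v * b y"
    using assms h unfolding convex_on_def by blast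
  also have "\<dots> \<le> u * max 0 (b x) + v * max 0 (b y)"
    using h by (intro add_mono mult_left_mono) auto
  finally have "max 0 (b (u *\<^sub>R x + v *\<^sub>R y)) \<le> u * max 0 (b x) + v * max 0 (b y)"
    using h by simp
  then show "u * (x * s - max 0 (b x)) + v * (y * s - max 0 (b y))
      \<le> (u *\<^sub>R x + v *\<^sub>R y) * s - max 0 (b (u *\<^sub>R x + v *\<^sub>R y))"
    by (simp add: algebra_simps)
qed simp

lemma concave_on_minus_linear:
  fixes a :: "real \<Rightarrow> real"
  assumes "concave_on {0..} a"
  shows "concave_on {0..} (\<lambda>y. a y - y * s)"
  unfolding concave_on_iff
proof (intro conjI ballI allI impI)
  fix x y u v :: real
  assume h: "x \<in> {0..}" "y \<in> {0..}" "0 \<le> u" "0 \<le> v" "u + v = 1"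
  have "u * a x + v * a y \<le> a (u *\<^sub>R x + v *\<^sub>R y)"
    using assms h unfolding concave_on_iff by blast
  then show "u * (a x - x * s) + v * (a y - y * s)
      \<le> a (u *\<^sub>R x + v *\<^sub>R y) - (u *\<^sub>R x + v *\<^sub>R y) * s"
    by (simp add: algebra_simps)
qed simp

section \<open>Liquidation values\<close>

lemma mem_uminus_solvency_set: "z \<in> uminus ` solvency_set L t \<omega> \<longleftrightarrow> 0 \<le> L t \<omega> (- z)"
proof
  assume "0 \<le> L t \<omega> (- z)"
  then have "- z \<in> solvency_set L t \<omega>" by (simp add: solvency_set_def)
  then show "z \<in> uminus ` solvency_set L t \<omega>" by (metis imageI minus_minus)
qed (auto simp: solvency_set_def)

lemma market_L_add_cash:
  "market_L b0 a0 Sb Sa t \<omega> (z + (x, 0)) = market_L b0 a0 Sb Sa t \<omega> z + x"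
  by (simp add: market_L_def liquidation_value_def)

lemma market_Lbar_add_cash: "market_Lbar sb sa t \<omega> (z + (x, 0)) = market_Lbar sb sa t \<omega> z + x"
  by (simp add: market_Lbar_def limit_liquidation_value_def)

lemma market_Lbar_scale:
  assumes "0 < r"
  shows "market_Lbar sb sa t \<omega> (r *\<^sub>R z) = r * market_Lbar sb sa t \<omega> z"
proof (cases "0 \<le> snd z")
  case True
  then have "0 \<le> snd (r *\<^sub>R z)" using assms by simp
  with True show ?thesis
    by (simp add: market_Lbar_def limit_liquidation_value_def distrib_left)
next
  case False
  then have "snd (r *\<^sub>R z) < 0" using assms by (simp add: mult_pos_neg)
  with False show ?thesis
    by (simp add: market_Lbar_def limit_liquidation_value_def distrib_left)
qed

lemma market_Lbar_0: "market_Lbar sb sa t \<omega> 0 = 0"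
  by (simp add: market_Lbar_def limit_liquidation_value_def)

lemma market_L_0: "b0 \<le> 0 \<Longrightarrow> market_L b0 a0 Sb Sa t \<omega> 0 = 0"
  by (simp add: market_L_def liquidation_value_def)

lemma measurable_market_Lbar:
  assumes [measurable]: "sb t \<in> borel_measurable N" "sa t \<in> borel_measurable N"
    and xi: "\<xi> \<in> borel_measurable N"
  shows "(\<lambda>\<omega>. market_Lbar sb sa t \<omega> (\<xi> \<omega>)) \<in> borel_measurable N"
proof -
  have [measurable]: "(\<lambda>\<omega>. fst (\<xi> \<omega>)) \<in> borel_measurable N" "(\<lambda>\<omega>. snd (\<xi> \<omega>)) \<in> borel_measurable N"
    by (rule borel_measurable_continuous_on[OF _ xi], intro continuous_intros)+
  show ?thesis
    unfolding market_Lbar_def limit_liquidation_value_def by measurable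
qed

section \<open>The gap between the market and its large-volume limit\<close>

context concave_cost_market
begin

abbreviation "Lv \<equiv> market_L b0 a0 Sb Sa"
abbreviation "Lv_inf \<equiv> market_Lbar sb sa"

text \<open>On the selling side nonnegativity uses that \<open>sb t \<omega>\<close> is nonnegative, which holds because
  selling more never brings in less: \<open>b0 + 1 * Sb t \<omega> 1 \<ge> b0\<close>.\<close>

lemma gap_concave:
  assumes t: "t \<le> T"
  shows "AE \<omega> in M. \<exists>f g. concave_on {0..} f \<and> concave_on {0..} g \<and>
    (\<forall>y\<ge>0. 0 \<le> f y) \<and> (\<forall>y\<ge>0. 0 \<le> g y) \<and>
    (\<forall>z. Lv_inf t \<omega> z - Lv t \<omega> z = (if 0 \<le> snd z then f (snd z) else g (- snd z)))"
  using bid_curve[OF t] sell_value[OF t] ask_curve[OF t] buy_cost[OF t]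
proof eventually_elim
  fix \<omega>
  assume bid: "mono_on {0..} (Sb t \<omega>) \<and> continuous_on {0..} (Sb t \<omega>) \<and>
          (Sb t \<omega> \<longlongrightarrow> sb t \<omega>) at_top \<and>
          (\<forall>\<^sub>F m in at_top. Sb t \<omega> differentiable (at m)) \<and>
          ((\<lambda>m. m * deriv (Sb t \<omega>) m) \<longlongrightarrow> 0) at_top"
    and sell: "mono_on {0..} (\<lambda>m. b0 + m * Sb t \<omega> m) \<and> convex_on {0..} (\<lambda>m. b0 + m * Sb t \<omega> m)"
    and ask: "antimono_on {0..} (Sa t \<omega>) \<and> continuous_on {0..} (Sa t \<omega>) \<and>
          (Sa t \<omega> \<longlongrightarrow> sa t \<omega>) at_top \<and>
          (\<forall>\<^sub>F l in at_top. Sa t \<omega> differentiable (at l)) \<and>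
          ((\<lambda>l. l * deriv (Sa t \<omega>) l) \<longlongrightarrow> 0) at_top"
    and buy: "mono_on {0..} (\<lambda>l. a0 + l * Sa t \<omega> l) \<and> concave_on {0..} (\<lambda>l. a0 + l * Sa t \<omega> l)"
  let ?f = "\<lambda>y. y * sb t \<omega> - max 0 (b0 + y * Sb t \<omega> y)"
  let ?g = "\<lambda>y. (a0 + y * Sa t \<omega> y) - y * sa t \<omega>"
  have bid_le: "Sb t \<omega> y \<le> sb t \<omega>" if "0 \<le> y" for y
  proof (rule tendsto_lowerbound)
    have "Sb t \<omega> y \<le> Sb t \<omega> m" if "y \<le> m" for m
      using bid[THEN conjunct1] \<open>0 \<le> y\<close> that by (simp add: mono_on_def)
    then show "\<forall>\<^sub>F m in at_top. Sb t \<omega> y \<le> Sb t \<omega> m"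
      by (rule eventually_at_top_linorderI)
  qed (use bid in \<open>simp_all only: trivial_limit_at_top_linorder not_False_eq_True\<close>)
  have ask_ge: "sa t \<omega> \<le> Sa t \<omega> y" if "0 \<le> y" for y
  proof (rule tendsto_upperbound)
    have "Sa t \<omega> m \<le> Sa t \<omega> y" if "y \<le> m" for m
      using ask[THEN conjunct1] \<open>0 \<le> y\<close> that by (simp add: monotone_on_def)
    then show "\<forall>\<^sub>F m in at_top. Sa t \<omega> m \<le> Sa t \<omega> y"
      by (rule eventually_at_top_linorderI)
  qed (use ask in \<open>simp_all only: trivial_limit_at_top_linorder not_False_eq_True\<close>)
  have "b0 + 0 * Sb t \<omega> 0 \<le> b0 + 1 * Sb t \<omega> 1"
    by (rule mono_onD[OF sell[THEN conjunct1]]) simp_all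
  with bid_le[of 1] have sb_nonneg: "0 \<le> sb t \<omega>" by simp
  have f_nonneg: "0 \<le> ?f y" if "0 \<le> y" for y
  proof -
    have "y * Sb t \<omega> y \<le> y * sb t \<omega>" using bid_le that by (intro mult_left_mono) auto
    moreover have "0 \<le> y * sb t \<omega>" using that sb_nonneg by simp
    ultimately show ?thesis using fixed_costs by auto
  qed
  have g_nonneg: "0 \<le> ?g y" if "0 \<le> y" for y
  proof -
    have "y * sa t \<omega> \<le> y * Sa t \<omega> y" using ask_ge that by (intro mult_left_mono) auto
    then show ?thesis using fixed_costs by auto
  qed
  have conc: "concave_on {0..} ?f" "concave_on {0..} ?g"
    by (rule concave_on_linear_minus_pos_part[OF sell[THEN conjunct2]],
        rule concave_on_minus_linear[OF buy[THEN conjunct2]])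
  have gap: "\<forall>z. Lv_inf t \<omega> z - Lv t \<omega> z = (if 0 \<le> snd z then ?f (snd z) else ?g (- snd z))"
    by (auto simp: market_Lbar_def market_L_def liquidation_value_def limit_liquidation_value_def)
  show "\<exists>f g. concave_on {0..} f \<and> concave_on {0..} g \<and>
    (\<forall>y\<ge>0. 0 \<le> f y) \<and> (\<forall>y\<ge>0. 0 \<le> g y) \<and>
    (\<forall>z. Lv_inf t \<omega> z - Lv t \<omega> z = (if 0 \<le> snd z then f (snd z) else g (- snd z)))"
    using conc f_nonneg g_nonneg gap by (intro exI[of _ ?f] exI[of _ ?g] conjI) simp_all
qed

lemma value_le_limit_value:
  assumes "t \<le> T"
  shows "AE \<omega> in M. \<forall>z. Lv t \<omega> z \<le> Lv_inf t \<omega> z"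
  using gap_concave[OF assms]
proof eventually_elim
  case (elim \<omega>)
  then obtain f g where nonneg: "\<And>y. 0 \<le> y \<Longrightarrow> 0 \<le> f y" "\<And>y. 0 \<le> y \<Longrightarrow> 0 \<le> g y"
    and gap: "\<And>z. Lv_inf t \<omega> z - Lv t \<omega> z = (if 0 \<le> snd z then f (snd z) else g (- snd z))"
    by blast
  have "0 \<le> Lv_inf t \<omega> z - Lv t \<omega> z" for z
    unfolding gap by (simp add: nonneg)
  then show ?case by simp
qed

lemma limit_value_strictly_better:
  assumes L1: "cond_L1 M F T Lv Lv_inf" and t: "t \<le> T"
  shows "AE \<omega> in M. \<forall>z. snd z \<noteq> 0 \<longrightarrow> Lv t \<omega> z < Lv_inf t \<omega> z"
proof -
  have strict: "AE \<omega> in M. Lv t \<omega> (0, y) < Lv_inf t \<omega> (0, y)" if y: "y \<noteq> 0" for y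
  proof -
    obtain c where "AE \<omega> in M. (c \<omega> :: real) > 0"
      and "AE \<omega> in M. Lv t \<omega> (0, y) \<le> Lv_inf t \<omega> (0, y) - c \<omega>"
      using L1 t y unfolding cond_L1_def by meson
    then show ?thesis by eventually_elim simp
  qed
  have "AE \<omega> in M. \<forall>n. Lv t \<omega> (0, real (Suc n)) < Lv_inf t \<omega> (0, real (Suc n))"
    unfolding AE_all_countable by (intro allI strict) simp
  moreover have "AE \<omega> in M. \<forall>n. Lv t \<omega> (0, - real (Suc n)) < Lv_inf t \<omega> (0, - real (Suc n))"
    unfolding AE_all_countable by (intro allI strict) simp
  ultimately show ?thesis
    using gap_concave[OF t]
  proof eventually_elim
    case (elim \<omega>)
    then obtain f g where conc: "concave_on {0..} f" "concave_on {0..} g"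
      and nonneg: "\<And>y. 0 \<le> y \<Longrightarrow> 0 \<le> f y" "\<And>y. 0 \<le> y \<Longrightarrow> 0 \<le> g y"
      and gap: "\<And>z. Lv_inf t \<omega> z - Lv t \<omega> z = (if 0 \<le> snd z then f (snd z) else g (- snd z))"
      by blast
    have fn: "0 < f (real (Suc n))" for n
      using elim(1)[rule_format, of n] gap[of "(0, real (Suc n))"] by (simp del: of_nat_Suc)
    have gn: "0 < g (real (Suc n))" for n
      using elim(2)[rule_format, of n] gap[of "(0, - real (Suc n))"] by (simp del: of_nat_Suc)
    have "0 < Lv_inf t \<omega> z - Lv t \<omega> z" if "snd z \<noteq> 0" for z
      unfolding gap
      using that concave_on_pos_from_integers[OF conc(1) nonneg(1) fn, of "snd z"]
        concave_on_pos_from_integers[OF conc(2) nonneg(2) gn, of "- snd z"]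
      by auto
    then show ?case by simp
  qed
qed

text \<open>The supremum over all \<open>y\<close> in \<open>(gL\<^sub>0)\<close> absorbs the scaling \<open>\<lambda>\<close>, since \<open>\<lambda> y\<close> ranges over all
  volumes. Hence one \<open>\<lambda> = r\<close> at which the supremum is below \<open>1\<close> already bounds the gap by \<open>r\<close>
  at every volume.\<close>

lemma limit_value_gap_bounded:
  assumes gL0: "cond_gL0 M T Lv Lv_inf"
  obtains C where "0 \<le> C" "\<And>t. t \<le> T \<Longrightarrow> AE \<omega> in M. \<forall>z. Lv_inf t \<omega> z - C \<le> Lv t \<omega> z"
proof -
  let ?d = "\<lambda>t r y. Linf_norm M (\<lambda>\<omega>. (Lv_inf t \<omega> (r *\<^sub>R (0, y)) - Lv t \<omega> (r *\<^sub>R (0, y))) / r)"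
  have "\<forall>\<^sub>F r in at_top. \<forall>t\<in>{..T}. (SUP y. ?d t r y) < 1"
    using gL0 unfolding cond_gL0_def
    by (intro eventually_ball_finite) (auto intro!: order_tendstoD(2))
  then have "\<forall>\<^sub>F r in at_top. (\<forall>t\<in>{..T}. (SUP y. ?d t r y) < 1) \<and> 1 \<le> r"
    by (intro eventually_conj eventually_ge_at_top)
  then obtain r :: real where sup: "\<And>t. t \<le> T \<Longrightarrow> (SUP y. ?d t r y) < 1" and r: "1 \<le> r"
    unfolding eventually_at_top_linorder by force
  have pointwise: "AE \<omega> in M. Lv_inf t \<omega> (0, y) - Lv t \<omega> (0, y) \<le> r" if t: "t \<le> T" for t y
  proof -
    have "?d t r (y / r) \<le> (SUP y. ?d t r y)" by (rule SUP_upper) simp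
    with sup[OF t] have less: "?d t r (y / r) < 1" by (rule le_less_trans[rotated])
    have "AE \<omega> in M. ereal \<bar>(Lv_inf t \<omega> (0, y) - Lv t \<omega> (0, y)) / r\<bar> \<le> ?d t r (y / r)"
      using esssup_AE[of "\<lambda>\<omega>. ereal \<bar>(Lv_inf t \<omega> (0, y) - Lv t \<omega> (0, y)) / r\<bar>" M] r
      by (simp add: Linf_norm_def)
    then show ?thesis
    proof eventually_elim
      case (elim \<omega>)
      then have "ereal \<bar>(Lv_inf t \<omega> (0, y) - Lv t \<omega> (0, y)) / r\<bar> < 1"
        using less by (rule le_less_trans)
      then have "\<bar>(Lv_inf t \<omega> (0, y) - Lv t \<omega> (0, y)) / r\<bar> < 1" by (simp add: one_ereal_def)
      then show ?case using r by (auto simp: abs_less_iff field_simps)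
    qed
  qed
  have "AE \<omega> in M. \<forall>z. Lv_inf t \<omega> z - 2 * r \<le> Lv t \<omega> z" if t: "t \<le> T" for t
  proof -
    have "AE \<omega> in M. \<forall>n. Lv_inf t \<omega> (0, real (Suc n)) - Lv t \<omega> (0, real (Suc n)) \<le> r"
      unfolding AE_all_countable by (intro allI pointwise t)
    moreover have "AE \<omega> in M. \<forall>n. Lv_inf t \<omega> (0, - real (Suc n)) - Lv t \<omega> (0, - real (Suc n)) \<le> r"
      unfolding AE_all_countable by (intro allI pointwise t)
    ultimately show ?thesis
      using gap_concave[OF t]
    proof eventually_elim
      case (elim \<omega>)
      then obtain f g where conc: "concave_on {0..} f" "concave_on {0..} g"
        and nonneg: "\<And>y. 0 \<le> y \<Longrightarrow> 0 \<le> f y" "\<And>y. 0 \<le> y \<Longrightarrow> 0 \<le> g y"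
        and gap: "\<And>z. Lv_inf t \<omega> z - Lv t \<omega> z = (if 0 \<le> snd z then f (snd z) else g (- snd z))"
        by blast
      have fn: "f (real (Suc n)) \<le> r" for n
        using elim(1)[rule_format, of n] gap[of "(0, real (Suc n))"] by (simp del: of_nat_Suc)
      have gn: "g (real (Suc n)) \<le> r" for n
        using elim(2)[rule_format, of n] gap[of "(0, - real (Suc n))"] by (simp del: of_nat_Suc)
      have "Lv_inf t \<omega> z - Lv t \<omega> z \<le> 2 * r" for z
        unfolding gap
        using concave_on_bounded_from_integers[OF conc(1) nonneg(1) fn, of "snd z"]
          concave_on_bounded_from_integers[OF conc(2) nonneg(2) gn, of "- snd z"]
        by auto
      then show ?case by (simp add: algebra_simps)
    qed
  qed
  then show ?thesis using r by (intro that[of "2 * r"]) auto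
qed

section \<open>The cycle of implications\<close>

lemma sets_F_subset_M: "t \<le> T \<Longrightarrow> B \<in> sets (F t) \<Longrightarrow> B \<in> sets M"
  using subalgebra_F[of t] by (auto simp: subalgebra_def)

lemma sets_F_mono: "s \<le> t \<Longrightarrow> t \<le> T \<Longrightarrow> B \<in> sets (F s) \<Longrightarrow> B \<in> sets (F t)"
  using F_mono[of s t] by (auto simp: subalgebra_def)

lemma measurable_F_mono:
  "s \<le> t \<Longrightarrow> t \<le> T \<Longrightarrow> f \<in> borel_measurable (F s) \<Longrightarrow> f \<in> borel_measurable (F t)"
  using measurable_from_subalg[OF F_mono] by blast

text \<open>The value at time \<open>T\<close> need not be measurable, but it is positive exactly on \<open>B\<close> up to a
  null set, so that this event belongs to the completion and has the measure of \<open>B\<close>.\<close>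

lemma strong_arbitrage_imp_arbitrage:
  assumes "strong_arbitrage M F T Lv"
  shows "arbitrage M F T Lv"
proof -
  obtain t B \<xi> m V where t: "t \<le> T" and B: "B \<in> sets (F t)" "measure M B > 0"
    and xi: "\<forall>i\<le>T. \<xi> i \<in> L0 M (F i) (\<lambda>\<omega>. uminus ` solvency_set Lv i \<omega>)"
    and early: "\<forall>i<t. AE \<omega> in M. \<xi> i \<omega> = 0"
    and off: "\<forall>i\<in>{t..T}. AE \<omega> in M. \<omega> \<notin> B \<longrightarrow> \<xi> i \<omega> = 0"
    and V: "V = (\<lambda>\<omega>. \<Sum>i\<le>T. \<xi> i \<omega>)"
    and gain: "AE \<omega> in M. \<omega> \<in> B \<longrightarrow> Lv T \<omega> (V \<omega>) \<ge> m \<omega> \<and> m \<omega> > 0"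
    using assms unfolding strong_arbitrage_def by blast
  have BM: "B \<in> sets M" using sets_F_subset_M t B by blast
  have "AE \<omega> in M. \<forall>i\<in>{..T}. \<omega> \<notin> B \<longrightarrow> \<xi> i \<omega> = 0"
  proof (intro eventually_ball_finite ballI)
    fix i assume "i \<in> {..T}"
    then consider "i < t" | "i \<in> {t..T}" by fastforce
    then show "AE \<omega> in M. \<omega> \<notin> B \<longrightarrow> \<xi> i \<omega> = 0"
    proof cases
      case 1
      then have "AE \<omega> in M. \<xi> i \<omega> = 0" using early by blast
      then show ?thesis by eventually_elim simp
    qed (use off in blast)
  qed simp
  then have off_zero: "AE \<omega> in M. \<omega> \<notin> B \<longrightarrow> Lv T \<omega> (V \<omega>) = 0"
    by eventually_elim (simp add: V market_L_0[OF fixed_costs(1)])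
  have nonneg: "AE \<omega> in M. Lv T \<omega> (V \<omega>) \<ge> 0"
    using off_zero gain by eventually_elim force
  define P where "P = {\<omega> \<in> space M. Lv T \<omega> (V \<omega>) > 0}"
  have P_eq: "AE \<omega> in completion M. \<omega> \<in> B \<longleftrightarrow> \<omega> \<in> P"
  proof (rule AE_completion)
    show "AE \<omega> in M. \<omega> \<in> B \<longleftrightarrow> \<omega> \<in> P"
      using off_zero gain AE_space by eventually_elim (auto simp: P_def)
  qed
  have "P \<in> sets (completion M)"
    by (rule completion.in_sets_AE[OF P_eq]) (use BM in \<open>auto simp: P_def\<close>)
  then have "measure (completion M) P = measure (completion M) B"
    using P_eq BM by (intro measure_eq_AE) auto
  also have "\<dots> = measure M B" using BM by simp
  finally have "measure (completion M) P > 0" using B by simp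
  then show ?thesis
    using xi V nonneg unfolding arbitrage_def P_def by blast
qed

text \<open>Since nothing happens before the first date with a nonzero trade, restricting all later trades
  to \<open>B\<close> does no harm, and the amount \<open>m\<close> collected on \<open>B\<close> at that date is a lower bound,
  known at the starting date, for the terminal value; the original arbitrage only needs to end
  with no loss.\<close>

lemma arbitrage_imp_limit_strong_arbitrage:
  assumes L1: "cond_L1 M F T Lv Lv_inf" and arb: "arbitrage M F T Lv"
  shows "strong_arbitrage M F T Lv_inf"
proof -
  obtain \<xi> V where xi: "\<And>t. t \<le> T \<Longrightarrow> \<xi> t \<in> L0 M (F t) (\<lambda>\<omega>. uminus ` solvency_set Lv t \<omega>)"
    and V: "V = (\<lambda>\<omega>. \<Sum>t\<le>T. \<xi> t \<omega>)" and nonneg: "AE \<omega> in M. Lv T \<omega> (V \<omega>) \<ge> 0"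
    and pos: "measure (completion M) {\<omega> \<in> space M. Lv T \<omega> (V \<omega>) > 0} > 0"
    using arb unfolding arbitrage_def by blast
  have xi_meas: "\<xi> i \<in> borel_measurable (F i)" if "i \<le> T" for i
    using xi[OF that] by (simp add: L0_def)
  have xi_solvent: "AE \<omega> in M. 0 \<le> Lv i \<omega> (- \<xi> i \<omega>)" if "i \<le> T" for i
    using xi[OF that] by (simp add: L0_def mem_uminus_solvency_set)
  define moves where "moves = (\<lambda>t. t \<le> T \<and> \<not> (AE \<omega> in M. \<xi> t \<omega> = 0))"
  have "\<exists>t. moves t"
  proof (rule ccontr)
    assume "\<not> (\<exists>t. moves t)"
    then have "AE \<omega> in M. \<forall>i\<in>{..T}. \<xi> i \<omega> = 0"
      by (intro eventually_ball_finite) (auto simp: moves_def)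
    then have "AE \<omega> in M. \<not> Lv T \<omega> (V \<omega>) > 0"
      by eventually_elim (simp add: V market_L_0[OF fixed_costs(1)])
    then have "emeasure (completion M) {\<omega> \<in> space (completion M). Lv T \<omega> (V \<omega>) > 0} = 0"
      by (intro emeasure_eq_0_AE AE_completion)
    then show False using pos by (simp add: measure_def)
  qed
  define t where "t = (LEAST t. moves t)"
  have "moves t" unfolding t_def using \<open>\<exists>t. moves t\<close> by (rule LeastI_ex)
  then have t: "t \<le> T" "\<not> (AE \<omega> in M. \<xi> t \<omega> = 0)" by (simp_all add: moves_def)
  have min: "AE \<omega> in M. \<xi> i \<omega> = 0" if "i < t" for i
  proof -
    have "\<not> moves i" using that unfolding t_def by (rule not_less_Least)
    then show ?thesis using that t(1) by (simp add: moves_def)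
  qed
  define B where "B = {\<omega> \<in> space (F t). \<xi> t \<omega> \<noteq> 0}"
  have space_F: "space (F t) = space M" using subalgebra_F[OF t(1)] by (simp add: subalgebra_def)
  have B: "B \<in> sets (F t)"
    unfolding B_def using xi_meas[OF t(1)] by measurable
  have BM: "B \<in> sets M" using B t sets_F_subset_M by blast
  have "measure M B \<noteq> 0"
  proof
    assume "measure M B = 0"
    then have "B \<in> null_sets M" using BM by (simp add: null_setsI emeasure_eq_measure)
    then have "AE \<omega> in M. \<omega> \<notin> B" by (rule AE_not_in)
    then have "AE \<omega> in M. \<xi> t \<omega> = 0"
      using AE_space by eventually_elim (simp add: B_def space_F)
    with t show False by simp
  qed
  then have B_pos: "measure M B > 0" by (simp add: zero_less_measure_iff)
  \<comment> \<open>The gain that the first nonzero trade leaves on the table, seen from the limit market.\<close>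
  define m where "m = (\<lambda>\<omega>. if \<omega> \<in> B then max 0 (Lv_inf t \<omega> (- \<xi> t \<omega>)) else 0)"
  have m_meas: "m \<in> borel_measurable (F t)"
  proof -
    have [measurable]: "(\<lambda>\<omega>. Lv_inf t \<omega> (- \<xi> t \<omega>)) \<in> borel_measurable (F t)"
      using bid_limit_measurable ask_limit_measurable xi_meas t
      by (intro measurable_market_Lbar) auto
    note B[measurable]
    show ?thesis unfolding m_def by measurable
  qed
  have m_pos: "AE \<omega> in M. \<omega> \<in> B \<longrightarrow> m \<omega> = Lv_inf t \<omega> (- \<xi> t \<omega>) \<and> 0 < m \<omega>"
    using xi_solvent[OF t(1)] limit_value_strictly_better[OF L1 t(1)]
      value_le_limit_value[OF t(1)]
  proof eventually_elim
    case (elim \<omega>)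
    show ?case
    proof
      assume wB: "\<omega> \<in> B"
      have "0 < Lv_inf t \<omega> (- \<xi> t \<omega>)"
      proof (cases "snd (\<xi> t \<omega>) = 0")
        case True
        \<comment> \<open>A pure cash trade that is solvent and nonzero throws cash away.\<close>
        then have "fst (\<xi> t \<omega>) \<noteq> 0" using wB by (auto simp: B_def prod_eq_iff)
        moreover have "0 \<le> Lv_inf t \<omega> (- \<xi> t \<omega>)" using elim(1) elim(3) order_trans by blast
        ultimately show ?thesis
          using True by (simp add: market_Lbar_def limit_liquidation_value_def)
      next
        case False
        then have "Lv t \<omega> (- \<xi> t \<omega>) < Lv_inf t \<omega> (- \<xi> t \<omega>)"
          using elim(2)[rule_format, of "- \<xi> t \<omega>"] by simp
        with elim(1) show ?thesis by simp
      qed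
      then show "m \<omega> = Lv_inf t \<omega> (- \<xi> t \<omega>) \<and> 0 < m \<omega>" using wB by (simp add: m_def)
    qed
  qed
  define \<zeta> where "\<zeta> = (\<lambda>i \<omega>. if i < t then 0
      else if \<omega> \<in> B then \<xi> i \<omega> + (if i = t then (m \<omega>, 0) else 0) else 0)"
  have zeta: "\<zeta> i \<in> L0 M (F i) (\<lambda>\<omega>. uminus ` solvency_set Lv_inf i \<omega>)" if i: "i \<le> T" for i
  proof -
    have "\<zeta> i \<in> borel_measurable (F i)"
    proof (cases "i < t")
      case False
      then have [measurable]: "B \<in> sets (F i)" "m \<in> borel_measurable (F i)"
        using sets_F_mono[OF _ i B] measurable_F_mono[OF _ i m_meas] by auto
      note xi_meas[OF i, measurable]
      show ?thesis using False unfolding \<zeta>_def by simp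
    qed (simp add: \<zeta>_def)
    moreover have "AE \<omega> in M. \<zeta> i \<omega> \<in> uminus ` solvency_set Lv_inf i \<omega>"
      using xi_solvent[OF i] value_le_limit_value[OF i] m_pos
    proof eventually_elim
      case (elim \<omega>)
      have solvent: "0 \<le> Lv_inf i \<omega> (- \<xi> i \<omega>)" using elim(1,2) order_trans by blast
      have "- \<xi> t \<omega> - (m \<omega>, 0) = - \<xi> t \<omega> + (- m \<omega>, 0)"
        by (simp add: prod_eq_iff)
      then have "Lv_inf t \<omega> (- \<xi> t \<omega> - (m \<omega>, 0)) = 0" if "\<omega> \<in> B"
        using that elim(3) by (simp only: market_Lbar_add_cash)
      then show ?case
        using solvent unfolding mem_uminus_solvency_set
        by (auto simp: \<zeta>_def market_Lbar_0 simp flip: zero_prod_def)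
    qed
    ultimately show ?thesis by (simp add: L0_def)
  qed
  have early: "AE \<omega> in M. \<forall>i\<in>{..<t}. \<xi> i \<omega> = 0"
    by (intro eventually_ball_finite) (auto intro: min)
  have gain: "AE \<omega> in M. \<omega> \<in> B \<longrightarrow> Lv_inf T \<omega> (\<Sum>i\<le>T. \<zeta> i \<omega>) \<ge> m \<omega> \<and> m \<omega> > 0"
    using early nonneg value_le_limit_value[OF order_refl] m_pos
  proof eventually_elim
    case (elim \<omega>)
    show ?case
    proof
      assume wB: "\<omega> \<in> B"
      have "(\<Sum>i\<le>T. \<zeta> i \<omega>) = (\<Sum>i\<le>T. \<xi> i \<omega> + (if i = t then (m \<omega>, 0) else 0))"
        using elim(1) wB by (intro sum.cong) (auto simp: \<zeta>_def)
      also have "\<dots> = V \<omega> + (m \<omega>, 0)"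
        using t by (simp add: sum.distrib V)
      finally have "Lv_inf T \<omega> (\<Sum>i\<le>T. \<zeta> i \<omega>) = Lv_inf T \<omega> (V \<omega>) + m \<omega>"
        by (simp add: market_Lbar_add_cash)
      moreover have "0 \<le> Lv_inf T \<omega> (V \<omega>)" using elim(2,3) order_trans by blast
      ultimately show "Lv_inf T \<omega> (\<Sum>i\<le>T. \<zeta> i \<omega>) \<ge> m \<omega> \<and> m \<omega> > 0"
        using elim(4) wB by simp
    qed
  qed
  show ?thesis
    unfolding strong_arbitrage_def
  proof (intro exI[of _ t] conjI bexI[of _ B] exI[of _ \<zeta>] exI[of _ m]
      exI[of _ "\<lambda>\<omega>. \<Sum>i\<le>T. \<zeta> i \<omega>"])
    show "AE \<omega> in M. \<omega> \<in> B \<longrightarrow> Lv_inf T \<omega> (\<Sum>i\<le>T. \<zeta> i \<omega>) \<ge> m \<omega> \<and> m \<omega> > 0" by (rule gain)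
  qed (use t B B_pos zeta m_meas in \<open>auto simp: \<zeta>_def m_def\<close>)
qed

text \<open>The lower bound \<open>m\<close> of the gain is known at the starting date, so scaling by \<open>k / m\<close> keeps
  every trade adapted and turns the random gain into the deterministic gain \<open>k\<close>.\<close>

lemma limit_strong_arbitrage_imp_strong_arbitrage:
  assumes gL0: "cond_gL0 M T Lv Lv_inf" and arb: "strong_arbitrage M F T Lv_inf"
  shows "strong_arbitrage M F T Lv"
proof -
  obtain C where C: "0 \<le> C" and gap: "\<And>t. t \<le> T \<Longrightarrow> AE \<omega> in M. \<forall>z. Lv_inf t \<omega> z - C \<le> Lv t \<omega> z"
    using limit_value_gap_bounded[OF gL0] by blast
  obtain t B \<xi> m V where t: "t \<le> T" and B: "B \<in> sets (F t)" "measure M B > 0"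
    and xi: "\<And>i. i \<le> T \<Longrightarrow> \<xi> i \<in> L0 M (F i) (\<lambda>\<omega>. uminus ` solvency_set Lv_inf i \<omega>)"
    and m: "m \<in> borel_measurable (F t)"
    and early: "\<And>i. i < t \<Longrightarrow> AE \<omega> in M. \<xi> i \<omega> = 0"
    and V: "V = (\<lambda>\<omega>. \<Sum>i\<le>T. \<xi> i \<omega>)"
    and gain: "AE \<omega> in M. \<omega> \<in> B \<longrightarrow> Lv_inf T \<omega> (V \<omega>) \<ge> m \<omega> \<and> m \<omega> > 0"
    using arb unfolding strong_arbitrage_def by blast
  \<comment> \<open>At most \<open>T + 1\<close> trades and the liquidation at time \<open>T\<close> cost \<open>C\<close> each; the scaled gain
    \<open>k\<close> pays for all of them and leaves one unit.\<close>
  define k where "k = (real T + 2) * C + 1"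
  have k: "0 < k" using C by (auto simp: k_def intro: add_nonneg_pos)
  define \<zeta> where "\<zeta> = (\<lambda>i \<omega>. if i < t then 0
      else if \<omega> \<in> B then (k / m \<omega>) *\<^sub>R \<xi> i \<omega> + (- C, 0) else 0)"
  have zeta: "\<zeta> i \<in> L0 M (F i) (\<lambda>\<omega>. uminus ` solvency_set Lv i \<omega>)" if i: "i \<le> T" for i
  proof -
    have "\<zeta> i \<in> borel_measurable (F i)"
    proof (cases "i < t")
      case False
      then have [measurable]: "B \<in> sets (F i)" "m \<in> borel_measurable (F i)"
        using sets_F_mono[OF _ i B(1)] measurable_F_mono[OF _ i m] by auto
      have [measurable]: "\<xi> i \<in> borel_measurable (F i)" using xi[OF i] by (simp add: L0_def)
      show ?thesis using False unfolding \<zeta>_def by simp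
    qed (simp add: \<zeta>_def)
    moreover have "AE \<omega> in M. 0 \<le> Lv_inf i \<omega> (- \<xi> i \<omega>)"
      using xi[OF i] by (simp add: L0_def mem_uminus_solvency_set)
    then have "AE \<omega> in M. \<zeta> i \<omega> \<in> uminus ` solvency_set Lv i \<omega>"
      using gap[OF i] gain
    proof eventually_elim
      case (elim \<omega>)
      show ?case
      proof (cases "i < t \<or> \<omega> \<notin> B")
        case True
        then have "\<zeta> i \<omega> = 0" by (auto simp: \<zeta>_def)
        then show ?thesis
          by (simp add: mem_uminus_solvency_set market_L_0[OF fixed_costs(1)])
      next
        case False
        then have r: "0 < k / m \<omega>" using elim(3) k by simp
        have "- \<zeta> i \<omega> = (k / m \<omega>) *\<^sub>R (- \<xi> i \<omega>) + (C, 0)" using False by (simp add: \<zeta>_def)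
        then have "Lv i \<omega> (- \<zeta> i \<omega>) = Lv i \<omega> ((k / m \<omega>) *\<^sub>R (- \<xi> i \<omega>)) + C"
          by (simp only: market_L_add_cash)
        also have "\<dots> \<ge> Lv_inf i \<omega> ((k / m \<omega>) *\<^sub>R (- \<xi> i \<omega>))"
          using elim(2)[rule_format, of "(k / m \<omega>) *\<^sub>R (- \<xi> i \<omega>)"] by linarith
        also have "Lv_inf i \<omega> ((k / m \<omega>) *\<^sub>R (- \<xi> i \<omega>)) = (k / m \<omega>) * Lv_inf i \<omega> (- \<xi> i \<omega>)"
          by (rule market_Lbar_scale[OF r])
        also have "\<dots> \<ge> 0" using r elim(1) by (intro mult_nonneg_nonneg) auto
        finally show ?thesis by (simp add: mem_uminus_solvency_set)
      qed
    qed
    ultimately show ?thesis by (simp add: L0_def)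
  qed
  have "AE \<omega> in M. \<forall>i\<in>{..<t}. \<xi> i \<omega> = 0"
    by (intro eventually_ball_finite) (auto intro: early)
  then have zeta_gain: "AE \<omega> in M. \<omega> \<in> B \<longrightarrow> Lv T \<omega> (\<Sum>i\<le>T. \<zeta> i \<omega>) \<ge> 1 \<and> (1::real) > 0"
    using gap[OF order_refl] gain
  proof eventually_elim
    case (elim \<omega>)
    show ?case
    proof
      assume wB: "\<omega> \<in> B"
      have m_pos: "0 < m \<omega>" and r: "0 < k / m \<omega>" using elim(3) k wB by auto
      define n where "n = card {t..T}"
      have split: "(\<Sum>i\<le>T. \<phi> i) = (\<Sum>i\<in>{t..T}. \<phi> i)"
        if "\<And>i. i < t \<Longrightarrow> \<phi> i = 0" for \<phi> :: "nat \<Rightarrow> real \<times> real"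
        using that by (intro sum.mono_neutral_right) auto
      have "(\<Sum>i\<le>T. \<zeta> i \<omega>) = (\<Sum>i\<in>{t..T}. \<zeta> i \<omega>)"
        by (intro split) (simp add: \<zeta>_def)
      also have "\<dots> = (\<Sum>i\<in>{t..T}. (k / m \<omega>) *\<^sub>R \<xi> i \<omega> + (- C, 0))"
        using wB by (intro sum.cong) (auto simp: \<zeta>_def)
      also have "\<dots> = (k / m \<omega>) *\<^sub>R (\<Sum>i\<in>{t..T}. \<xi> i \<omega>) + real n *\<^sub>R (- C, 0)"
        unfolding sum.distrib scaleR_sum_right sum_constant_scaleR n_def ..
      also have "(\<Sum>i\<in>{t..T}. \<xi> i \<omega>) = V \<omega>"
        unfolding V using elim(1) by (intro split[symmetric]) auto
      also have "real n *\<^sub>R (- C, 0 :: real) = (- (real n * C), 0)" by simp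
      finally have "Lv T \<omega> (\<Sum>i\<le>T. \<zeta> i \<omega>) = Lv T \<omega> ((k / m \<omega>) *\<^sub>R V \<omega>) - real n * C"
        by (simp add: market_L_add_cash)
      moreover have "Lv_inf T \<omega> ((k / m \<omega>) *\<^sub>R V \<omega>) - C \<le> Lv T \<omega> ((k / m \<omega>) *\<^sub>R V \<omega>)"
        using elim(2) by blast
      moreover have "Lv_inf T \<omega> ((k / m \<omega>) *\<^sub>R V \<omega>) = (k / m \<omega>) * Lv_inf T \<omega> (V \<omega>)"
        by (rule market_Lbar_scale[OF r])
      moreover have "(k / m \<omega>) * m \<omega> \<le> (k / m \<omega>) * Lv_inf T \<omega> (V \<omega>)"
        using elim(3) wB r by (intro mult_left_mono) auto
      moreover have "(k / m \<omega>) * m \<omega> = k" using m_pos by simp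
      moreover have "real n * C \<le> (real T + 1) * C"
        using C by (intro mult_right_mono) (auto simp: n_def)
      ultimately have "Lv T \<omega> (\<Sum>i\<le>T. \<zeta> i \<omega>) \<ge> 1" by (simp add: k_def algebra_simps)
      then show "Lv T \<omega> (\<Sum>i\<le>T. \<zeta> i \<omega>) \<ge> 1 \<and> (1::real) > 0" by simp
    qed
  qed
  show ?thesis
    unfolding strong_arbitrage_def
  proof (intro exI[of _ t] conjI bexI[of _ B] exI[of _ \<zeta>] exI[of _ "\<lambda>_. 1"]
      exI[of _ "\<lambda>\<omega>. \<Sum>i\<le>T. \<zeta> i \<omega>"])
    show "AE \<omega> in M. \<omega> \<in> B \<longrightarrow> Lv T \<omega> (\<Sum>i\<le>T. \<zeta> i \<omega>) \<ge> 1 \<and> (1::real) > 0" by (rule zeta_gain)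
  qed (use t B zeta in \<open>auto simp: \<zeta>_def\<close>)
qed

end

theorem theorem3p9:
  fixes M :: "'a measure" and F :: "nat \<Rightarrow> 'a measure" and T :: nat
    and b0 a0 :: real
    and Sb Sa :: "nat \<Rightarrow> 'a \<Rightarrow> real \<Rightarrow> real"
    and sb sa :: "nat \<Rightarrow> 'a \<Rightarrow> real"
    and L Lbar :: "nat \<Rightarrow> 'a \<Rightarrow> real \<times> real \<Rightarrow> real"
  assumes market: "concave_cost_market M F T b0 a0 Sb Sa sb sa"
    and L: "L = market_L b0 a0 Sb Sa"
    and Lbar: "Lbar = market_Lbar sb sa"
    and gL0: "cond_gL0 M T L Lbar"
    and L1: "cond_L1 M F T L Lbar"
  shows "(arbitrage M F T L \<longleftrightarrow> strong_arbitrage M F T L) \<and>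
         (strong_arbitrage M F T L \<longleftrightarrow> strong_arbitrage M F T Lbar)"
proof -
  interpret concave_cost_market M F T b0 a0 Sb Sa sb sa by (rule market)
  show ?thesis
    using strong_arbitrage_imp_arbitrage
      arbitrage_imp_limit_strong_arbitrage[OF L1[unfolded L Lbar]]
      limit_strong_arbitrage_imp_strong_arbitrage[OF gL0[unfolded L Lbar]]
    unfolding L Lbar by blast
qed

end
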